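(* Let $R$ be an associative ring with unit. Every Ziegler small extension $u:M\rightarrow E$ of right $R$-modules with $E$ pure-injective is a left minimal monomorphism.
   Context: A morphism $u:M\rightarrow E$ is left minimal if every endomorphism $g:E\rightarrow E$ with $gu=u$ is an isomorphism. Let $u:K\rightarrow M$ be a monomorphism and $f:K\rightarrow N$ a morphism, and consider the pushout of $f$ and $u$, with structure maps $\overline f:M\rightarrow P$ and $\overline u:N\rightarrow P$, so that $\overline f u=\overline u f$. The morphism $f$ is called a partial isomorphism from $M$ to $N$ with domain $K$ if both $\overline u$ and $\overline f$ are pure monomorphisms. The monomorphism $u:K\rightarrow M$ is called a Ziegler small extension if for any morphism $g:M\rightarrow N$ such that $gu$ is a partial isomorphism from $M$ to $N$ with domain $K$, $g$ is a pure monomorphism. *)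

theory Defs
  imports "HOL-Algebra.Module" "HOL-Algebra.AbelCoset"
begin

text \<open>
  Right modules over an arbitrary ring with unit. They reuse the record of \<open>HOL-Algebra.Module\<close>
  (whose locale \<open>module\<close> needs a commutative ring), with \<open>r \<odot>\<^bsub>M\<^esub> x\<close> standing for the
  product \<open>x r\<close>; hence the order of the factors in \<open>smult_assoc\<close>. The multiplicative fields
  \<open>mult\<close> and \<open>one\<close> of the record play no role.
\<close>

locale right_module = R?: ring R + M?: abelian_group M
  for R :: "('r, 'x) ring_scheme" (structure) and M :: "('r, 'm) module" (structure) +
  assumes smult_closed:
      "\<lbrakk>r \<in> carrier R; x \<in> carrier M\<rbrakk> \<Longrightarrow> r \<odot>\<^bsub>M\<^esub> x \<in> carrier M"
    and smult_l_distr: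
      "\<lbrakk>r \<in> carrier R; s \<in> carrier R; x \<in> carrier M\<rbrakk> \<Longrightarrow>
        (r \<oplus> s) \<odot>\<^bsub>M\<^esub> x = r \<odot>\<^bsub>M\<^esub> x \<oplus>\<^bsub>M\<^esub> s \<odot>\<^bsub>M\<^esub> x"
    and smult_r_distr:
      "\<lbrakk>r \<in> carrier R; x \<in> carrier M; y \<in> carrier M\<rbrakk> \<Longrightarrow>
        r \<odot>\<^bsub>M\<^esub> (x \<oplus>\<^bsub>M\<^esub> y) = r \<odot>\<^bsub>M\<^esub> x \<oplus>\<^bsub>M\<^esub> r \<odot>\<^bsub>M\<^esub> y"
    and smult_assoc:
      "\<lbrakk>r \<in> carrier R; s \<in> carrier R; x \<in> carrier M\<rbrakk> \<Longrightarrow>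
        (r \<otimes> s) \<odot>\<^bsub>M\<^esub> x = s \<odot>\<^bsub>M\<^esub> (r \<odot>\<^bsub>M\<^esub> x)"
    and smult_one:
      "x \<in> carrier M \<Longrightarrow> \<one> \<odot>\<^bsub>M\<^esub> x = x"

definition mod_hom ::
  "('r, 'x) ring_scheme \<Rightarrow> ('r, 'm) module \<Rightarrow> ('r, 'n) module \<Rightarrow> ('m \<Rightarrow> 'n) set" where
  "mod_hom R M N = {h \<in> carrier M \<rightarrow> carrier N.
     (\<forall>x\<in>carrier M. \<forall>y\<in>carrier M. h (x \<oplus>\<^bsub>M\<^esub> y) = h x \<oplus>\<^bsub>N\<^esub> h y) \<and>
     (\<forall>r\<in>carrier R. \<forall>x\<in>carrier M. h (r \<odot>\<^bsub>M\<^esub> x) = r \<odot>\<^bsub>N\<^esub> h x)}"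

definition mod_mono ::
  "('r, 'x) ring_scheme \<Rightarrow> ('r, 'm) module \<Rightarrow> ('r, 'n) module \<Rightarrow> ('m \<Rightarrow> 'n) \<Rightarrow> bool" where
  "mod_mono R M N h \<longleftrightarrow> h \<in> mod_hom R M N \<and> inj_on h (carrier M)"

definition mod_iso ::
  "('r, 'x) ring_scheme \<Rightarrow> ('r, 'm) module \<Rightarrow> ('r, 'n) module \<Rightarrow> ('m \<Rightarrow> 'n) \<Rightarrow> bool" where
  "mod_iso R M N h \<longleftrightarrow> h \<in> mod_hom R M N \<and> bij_betw h (carrier M) (carrier N)"

text \<open>
  Purity: a finite system of linear equations \<open>\<Sum>i<n. X i * r i j = a j\<close> (\<open>j < m\<close>) with
  coefficients in \<open>R\<close> and constants in \<open>M\<close> that becomes solvable in \<open>N\<close> is solvable in \<open>M\<close>.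
  Unlike the formulation by tensor products this needs no quantification over modules.
\<close>

definition pure_mono ::
  "('r, 'x) ring_scheme \<Rightarrow> ('r, 'm) module \<Rightarrow> ('r, 'n) module \<Rightarrow> ('m \<Rightarrow> 'n) \<Rightarrow> bool" where
  "pure_mono R M N h \<longleftrightarrow> mod_mono R M N h \<and>
    (\<forall>(n::nat) (m::nat) r a.
      (\<forall>i<n. \<forall>j<m. r i j \<in> carrier R) \<longrightarrow> (\<forall>j<m. a j \<in> carrier M) \<longrightarrow>
      (\<exists>y. (\<forall>i<n. y i \<in> carrier N) \<and>
           (\<forall>j<m. (\<Oplus>\<^bsub>N\<^esub>i\<in>{..<n}. r i j \<odot>\<^bsub>N\<^esub> y i) = h (a j))) \<longrightarrow>
      (\<exists>x. (\<forall>i<n. x i \<in> carrier M) \<and>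
           (\<forall>j<m. (\<Oplus>\<^bsub>M\<^esub>i\<in>{..<n}. r i j \<odot>\<^bsub>M\<^esub> x i) = a j)))"

text \<open>
  The type \<open>'u\<close> is the universe over which the test modules \<open>A\<close> and \<open>B\<close> range. HOL cannot
  quantify over all types; when \<open>'u\<close> is infinite and at least as large as \<open>R\<close>, the
  choice of \<open>'u\<close> does not matter: pure-injectivity is algebraic compactness, and a failure of
  that is witnessed in some \<open>B\<close> of size at most \<open>|E| + |R| + \<aleph>\<^sub>0\<close> by downward
  Loewenheim-Skolem.
\<close>

definition pure_injective :: "('r, 'x) ring_scheme \<Rightarrow> ('r, 'u) module \<Rightarrow> bool" where
  "pure_injective R E \<longleftrightarrow> right_module R E \<and>
    (\<forall>(A :: ('r, 'u) module) (B :: ('r, 'u) module) i h.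
      right_module R A \<longrightarrow> right_module R B \<longrightarrow> pure_mono R A B i \<longrightarrow> h \<in> mod_hom R A E \<longrightarrow>
      (\<exists>h'\<in>mod_hom R B E. \<forall>x\<in>carrier A. h' (i x) = h x))"

definition left_minimal ::
  "('r, 'x) ring_scheme \<Rightarrow> ('r, 'm) module \<Rightarrow> ('r, 'e) module \<Rightarrow> ('m \<Rightarrow> 'e) \<Rightarrow> bool" where
  "left_minimal R M E u \<longleftrightarrow> u \<in> mod_hom R M E \<and>
    (\<forall>g\<in>mod_hom R E E. (\<forall>x\<in>carrier M. g (u x) = u x) \<longrightarrow> mod_iso R E E g)"

text \<open>
  The pushout of \<open>u\<close> and \<open>f\<close> is the quotient of the direct sum of \<open>M\<close> and \<open>N\<close> by the
  submodule of all \<open>(u k, - f k)\<close>.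
\<close>

definition mod_sum :: "('r, 'm) module \<Rightarrow> ('r, 'n) module \<Rightarrow> ('r, 'm \<times> 'n) module" where
  "mod_sum M N = \<lparr>carrier = carrier M \<times> carrier N, mult = undefined, one = undefined,
     zero = (\<zero>\<^bsub>M\<^esub>, \<zero>\<^bsub>N\<^esub>), add = (\<lambda>(x, y) (x', y'). (x \<oplus>\<^bsub>M\<^esub> x', y \<oplus>\<^bsub>N\<^esub> y')),
     smult = (\<lambda>r (x, y). (r \<odot>\<^bsub>M\<^esub> x, r \<odot>\<^bsub>N\<^esub> y))\<rparr>"

definition mod_quot :: "('r, 'm) module \<Rightarrow> 'm set \<Rightarrow> ('r, 'm set) module" where
  "mod_quot M S = \<lparr>carrier = a_rcosets\<^bsub>M\<^esub> S, mult = undefined, one = undefined,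
     zero = S, add = set_add M, smult = (\<lambda>r X. \<Union>x\<in>X. S +>\<^bsub>M\<^esub> (r \<odot>\<^bsub>M\<^esub> x))\<rparr>"

definition pushout_rel ::
  "('r, 'k) module \<Rightarrow> ('r, 'n) module \<Rightarrow> ('k \<Rightarrow> 'm) \<Rightarrow> ('k \<Rightarrow> 'n) \<Rightarrow> ('m \<times> 'n) set" where
  "pushout_rel K N u f = (\<lambda>k. (u k, \<ominus>\<^bsub>N\<^esub> f k)) ` carrier K"

definition pushout ::
  "('r, 'k) module \<Rightarrow> ('r, 'm) module \<Rightarrow> ('r, 'n) module \<Rightarrow> ('k \<Rightarrow> 'm) \<Rightarrow> ('k \<Rightarrow> 'n) \<Rightarrow>
    ('r, ('m \<times> 'n) set) module" where
  "pushout K M N u f = mod_quot (mod_sum M N) (pushout_rel K N u f)"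

definition pushout_inl ::
  "('r, 'k) module \<Rightarrow> ('r, 'm) module \<Rightarrow> ('r, 'n) module \<Rightarrow> ('k \<Rightarrow> 'm) \<Rightarrow> ('k \<Rightarrow> 'n) \<Rightarrow>
    'm \<Rightarrow> ('m \<times> 'n) set" where
  "pushout_inl K M N u f x = pushout_rel K N u f +>\<^bsub>mod_sum M N\<^esub> (x, \<zero>\<^bsub>N\<^esub>)"

definition pushout_inr ::
  "('r, 'k) module \<Rightarrow> ('r, 'm) module \<Rightarrow> ('r, 'n) module \<Rightarrow> ('k \<Rightarrow> 'm) \<Rightarrow> ('k \<Rightarrow> 'n) \<Rightarrow>
    'n \<Rightarrow> ('m \<times> 'n) set" where
  "pushout_inr K M N u f y = pushout_rel K N u f +>\<^bsub>mod_sum M N\<^esub> (\<zero>\<^bsub>M\<^esub>, y)"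

text \<open>\<open>partial_isomorphism R K M N u f\<close>: here \<open>u\<close> embeds the domain \<open>K\<close> into \<open>M\<close>, and
  \<open>f\<close> maps it to \<open>N\<close>.\<close>

definition partial_isomorphism ::
  "('r, 'x) ring_scheme \<Rightarrow> ('r, 'k) module \<Rightarrow> ('r, 'm) module \<Rightarrow> ('r, 'n) module \<Rightarrow>
    ('k \<Rightarrow> 'm) \<Rightarrow> ('k \<Rightarrow> 'n) \<Rightarrow> bool" where
  "partial_isomorphism R K M N u f \<longleftrightarrow> mod_mono R K M u \<and> f \<in> mod_hom R K N \<and>
    pure_mono R N (pushout K M N u f) (pushout_inr K M N u f) \<and>
    pure_mono R M (pushout K M N u f) (pushout_inl K M N u f)"

text \<open>As in \<open>pure_injective\<close>, the type \<open>'u\<close> is the universe for the test module \<open>N\<close>. The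
  pushout lives in a larger type, which does no harm as \<open>pure_mono\<close> makes sense for any types.\<close>

definition ziegler_small_extension ::
  "('r, 'x) ring_scheme \<Rightarrow> ('r, 'u) module \<Rightarrow> ('r, 'u) module \<Rightarrow> ('u \<Rightarrow> 'u) \<Rightarrow> bool" where
  "ziegler_small_extension R K M u \<longleftrightarrow> mod_mono R K M u \<and>
    (\<forall>(N :: ('r, 'u) module) g. right_module R N \<longrightarrow> g \<in> mod_hom R M N \<longrightarrow>
      partial_isomorphism R K M N u (g \<circ> u) \<longrightarrow> pure_mono R M N g)"

subsection \<open>The pushout has its universal property\<close>

lemma mod_homD:
  assumes "h \<in> mod_hom R M N"
  shows "x \<in> carrier M \<Longrightarrow> h x \<in> carrier N"
    and "\<lbrakk>x \<in> carrier M; y \<in> carrier M\<rbrakk> \<Longrightarrow> h (x \<oplus>\<^bsub>M\<^esub> y) = h x \<oplus>\<^bsub>N\<^esub> h y"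
    and "\<lbrakk>r \<in> carrier R; x \<in> carrier M\<rbrakk> \<Longrightarrow> h (r \<odot>\<^bsub>M\<^esub> x) = r \<odot>\<^bsub>N\<^esub> h x"
  using assms by (auto simp: mod_hom_def)

lemma mod_homI:
  assumes "\<And>x. x \<in> carrier M \<Longrightarrow> h x \<in> carrier N"
    and "\<And>x y. \<lbrakk>x \<in> carrier M; y \<in> carrier M\<rbrakk> \<Longrightarrow> h (x \<oplus>\<^bsub>M\<^esub> y) = h x \<oplus>\<^bsub>N\<^esub> h y"
    and "\<And>r x. \<lbrakk>r \<in> carrier R; x \<in> carrier M\<rbrakk> \<Longrightarrow> h (r \<odot>\<^bsub>M\<^esub> x) = r \<odot>\<^bsub>N\<^esub> h x"
  shows "h \<in> mod_hom R M N"
  using assms by (auto simp: mod_hom_def)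

lemma mod_hom_zero:
  assumes "right_module R M" "right_module R N" "h \<in> mod_hom R M N"
  shows "h \<zero>\<^bsub>M\<^esub> = \<zero>\<^bsub>N\<^esub>"
proof -
  interpret M: right_module R M by fact
  interpret N: right_module R N by fact
  have z: "h \<zero>\<^bsub>M\<^esub> \<in> carrier N"
    using mod_homD(1)[OF assms(3)] by simp
  have "h \<zero>\<^bsub>M\<^esub> \<oplus>\<^bsub>N\<^esub> h \<zero>\<^bsub>M\<^esub> = h \<zero>\<^bsub>M\<^esub>"
    using mod_homD(2)[OF assms(3) M.M.zero_closed M.M.zero_closed] by simp
  then show ?thesis
    using N.M.add.l_cancel_one[OF z z] by simp
qed

lemma mod_hom_minus:
  assumes "right_module R M" "right_module R N" "h \<in> mod_hom R M N" "x \<in> carrier M"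
  shows "h (\<ominus>\<^bsub>M\<^esub> x) = \<ominus>\<^bsub>N\<^esub> h x"
proof -
  interpret M: right_module R M by fact
  interpret N: right_module R N by fact
  have "h (\<ominus>\<^bsub>M\<^esub> x) \<oplus>\<^bsub>N\<^esub> h x = \<zero>\<^bsub>N\<^esub>"
    using mod_homD(2)[OF assms(3), of "\<ominus>\<^bsub>M\<^esub> x" x] assms(4) mod_hom_zero[OF assms(1-3)]
    by (simp add: M.M.l_neg)
  then show ?thesis
    using mod_homD(1)[OF assms(3)] assms(4) N.M.minus_equality by force
qed

lemma (in right_module) smult_zero:
  assumes r: "r \<in> carrier R"
  shows "r \<odot>\<^bsub>M\<^esub> \<zero>\<^bsub>M\<^esub> = \<zero>\<^bsub>M\<^esub>"
  using smult_r_distr[OF r M.zero_closed M.zero_closed] smult_closed[OF r M.zero_closed]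
  by (metis M.add.l_cancel_one' M.l_zero M.zero_closed)

lemma (in right_module) smult_minus:
  assumes r: "r \<in> carrier R" and x: "x \<in> carrier M"
  shows "r \<odot>\<^bsub>M\<^esub> (\<ominus>\<^bsub>M\<^esub> x) = \<ominus>\<^bsub>M\<^esub> (r \<odot>\<^bsub>M\<^esub> x)"
proof -
  have "r \<odot>\<^bsub>M\<^esub> (\<ominus>\<^bsub>M\<^esub> x) \<oplus>\<^bsub>M\<^esub> r \<odot>\<^bsub>M\<^esub> x = \<zero>\<^bsub>M\<^esub>"
    using smult_r_distr[OF r, of "\<ominus>\<^bsub>M\<^esub> x" x] x smult_zero[OF r] by (simp add: M.l_neg)
  then show ?thesis
    using M.minus_equality smult_closed[OF r] x by force
qed

lemma right_module_mod_sum: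
  assumes "right_module R M" "right_module R N"
  shows "right_module R (mod_sum M N)"
proof -
  interpret M: right_module R M by fact
  interpret N: right_module R N by fact
  have "abelian_group (mod_sum M N)"
  proof (rule abelian_groupI)
    fix x assume "x \<in> carrier (mod_sum M N)"
    then show "\<exists>y\<in>carrier (mod_sum M N). y \<oplus>\<^bsub>mod_sum M N\<^esub> x = \<zero>\<^bsub>mod_sum M N\<^esub>"
      by (intro bexI[of _ "(\<ominus>\<^bsub>M\<^esub> fst x, \<ominus>\<^bsub>N\<^esub> snd x)"])
        (auto simp: mod_sum_def M.M.l_neg N.M.l_neg)
  qed (auto simp: mod_sum_def M.M.a_ac N.M.a_ac)
  then show ?thesis
    by (intro right_module.intro M.R.ring_axioms right_module_axioms.intro)
      (auto simp: mod_sum_def M.smult_closed N.smult_closed M.smult_l_distr N.smult_l_distr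
        M.smult_r_distr N.smult_r_distr M.smult_assoc N.smult_assoc M.smult_one N.smult_one)
qed

locale submodule_of = right_module R M for R :: "('r, 'x) ring_scheme" (structure)
    and M :: "('r, 'm) module" (structure) +
  fixes S :: "'m set"
  assumes S_add: "additive_subgroup S M"
    and S_smult: "\<lbrakk>r \<in> carrier R; x \<in> S\<rbrakk> \<Longrightarrow> r \<odot>\<^bsub>M\<^esub> x \<in> S"
begin

sublocale S: abelian_subgroup S M
  by (rule abelian_subgroupI3[OF S_add M.abelian_group_axioms])

lemma coset_eq_iff:
  assumes "x \<in> carrier M" "y \<in> carrier M"
  shows "S +>\<^bsub>M\<^esub> x = S +>\<^bsub>M\<^esub> y \<longleftrightarrow> x \<oplus>\<^bsub>M\<^esub> \<ominus>\<^bsub>M\<^esub> y \<in> S"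
proof -
  have "x \<in> S +>\<^bsub>M\<^esub> y \<longleftrightarrow> x \<oplus>\<^bsub>M\<^esub> \<ominus>\<^bsub>M\<^esub> y \<in> S"
    using assms by (simp add: S.a_rcos_module)
  moreover have "S +>\<^bsub>M\<^esub> y = S +>\<^bsub>M\<^esub> x" if "x \<in> S +>\<^bsub>M\<^esub> y"
    by (rule M.a_repr_independence[OF that assms(2) S.a_subgroup])
  ultimately show ?thesis
    using S.a_rcos_self[OF assms(1)] by auto
qed

lemma quot_smult_coset:
  assumes r: "r \<in> carrier R" and x: "x \<in> carrier M"
  shows "r \<odot>\<^bsub>mod_quot M S\<^esub> (S +>\<^bsub>M\<^esub> x) = S +>\<^bsub>M\<^esub> (r \<odot>\<^bsub>M\<^esub> x)"
proof -
  have "S +>\<^bsub>M\<^esub> (r \<odot>\<^bsub>M\<^esub> y) = S +>\<^bsub>M\<^esub> (r \<odot>\<^bsub>M\<^esub> x)" if y: "y \<in> S +>\<^bsub>M\<^esub> x" for y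
  proof -
    have yc: "y \<in> carrier M"
      using y S.a_elemrcos_carrier x by blast
    have "y \<oplus>\<^bsub>M\<^esub> \<ominus>\<^bsub>M\<^esub> x \<in> S"
      using y yc x S.a_rcos_module by metis
    then have "r \<odot>\<^bsub>M\<^esub> (y \<oplus>\<^bsub>M\<^esub> \<ominus>\<^bsub>M\<^esub> x) \<in> S"
      by (rule S_smult[OF r])
    then show ?thesis
      using r x yc by (simp add: coset_eq_iff smult_closed smult_r_distr smult_minus)
  qed
  then have "(\<Union>y\<in>S +>\<^bsub>M\<^esub> x. S +>\<^bsub>M\<^esub> (r \<odot>\<^bsub>M\<^esub> y)) = S +>\<^bsub>M\<^esub> (r \<odot>\<^bsub>M\<^esub> x)"
    using S.a_rcos_self[OF x] by blast
  then show ?thesis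
    by (simp add: mod_quot_def)
qed

lemma quot_add_coset:
  assumes "x \<in> carrier M" "y \<in> carrier M"
  shows "(S +>\<^bsub>M\<^esub> x) \<oplus>\<^bsub>mod_quot M S\<^esub> (S +>\<^bsub>M\<^esub> y) = S +>\<^bsub>M\<^esub> (x \<oplus>\<^bsub>M\<^esub> y)"
  using assms by (simp add: mod_quot_def S.a_rcos_sum)

lemma quot_zero: "\<zero>\<^bsub>mod_quot M S\<^esub> = S +>\<^bsub>M\<^esub> \<zero>\<^bsub>M\<^esub>"
  using M.a_coset_add_zero[OF S.a_subset] by (simp add: mod_quot_def)

lemma quot_carrier: "carrier (mod_quot M S) = (\<lambda>x. S +>\<^bsub>M\<^esub> x) ` carrier M"
  by (auto simp: mod_quot_def A_RCOSETS_def')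

lemma right_module_quot: "right_module R (mod_quot M S)"
proof -
  have "abelian_group (mod_quot M S)"
  proof (rule abelian_groupI)
    fix X assume "X \<in> carrier (mod_quot M S)"
    then obtain x where x: "x \<in> carrier M" "X = S +>\<^bsub>M\<^esub> x"
      by (auto simp: quot_carrier)
    then have "(S +>\<^bsub>M\<^esub> \<ominus>\<^bsub>M\<^esub> x) \<oplus>\<^bsub>mod_quot M S\<^esub> X = \<zero>\<^bsub>mod_quot M S\<^esub>"
      by (simp add: quot_add_coset M.l_neg quot_zero)
    then show "\<exists>Y\<in>carrier (mod_quot M S). Y \<oplus>\<^bsub>mod_quot M S\<^esub> X = \<zero>\<^bsub>mod_quot M S\<^esub>"
      using x by (auto simp: quot_carrier)
  qed (auto simp: quot_carrier quot_add_coset quot_zero M.a_ac)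
  then show ?thesis
    by (intro right_module.intro R.ring_axioms right_module_axioms.intro)
      (auto simp: quot_carrier quot_smult_coset quot_add_coset smult_closed smult_l_distr
        smult_r_distr smult_assoc smult_one)
qed

lemma coset_hom: "(\<lambda>x. S +>\<^bsub>M\<^esub> x) \<in> mod_hom R M (mod_quot M S)"
  by (rule mod_homI) (auto simp: quot_carrier quot_smult_coset quot_add_coset)

lemma quot_lift:
  assumes T: "right_module R T" and h: "h \<in> mod_hom R M T"
    and z: "\<And>s. s \<in> S \<Longrightarrow> h s = \<zero>\<^bsub>T\<^esub>"
  shows "\<exists>h'\<in>mod_hom R (mod_quot M S) T. \<forall>x\<in>carrier M. h' (S +>\<^bsub>M\<^esub> x) = h x"
proof -
  interpret T: right_module R T by fact
  define h' where "h' X = h (SOME x. x \<in> X)" for X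
  have h'h: "h' (S +>\<^bsub>M\<^esub> x) = h x" if x: "x \<in> carrier M" for x
  proof -
    define y where "y = (SOME y. y \<in> S +>\<^bsub>M\<^esub> x)"
    have y: "y \<in> S +>\<^bsub>M\<^esub> x"
      unfolding y_def by (rule someI[where P = "\<lambda>y. y \<in> S +>\<^bsub>M\<^esub> x", OF S.a_rcos_self[OF x]])
    then obtain s where s: "s \<in> S" "y = s \<oplus>\<^bsub>M\<^esub> x"
      by (auto simp: a_r_coset_def')
    then have "h y = h s \<oplus>\<^bsub>T\<^esub> h x"
      using x mod_homD(2)[OF h] S.a_Hcarr by blast
    then show ?thesis
      using z[OF s(1)] mod_homD(1)[OF h x] by (simp add: h'_def y_def)
  qed
  moreover have "h' \<in> mod_hom R (mod_quot M S) T"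
    by (rule mod_homI)
      (auto simp: quot_carrier quot_smult_coset quot_add_coset h'h mod_homD[OF h] smult_closed)
  ultimately show ?thesis by blast
qed

end

locale pushout_data =
  fixes R :: "('r, 'x) ring_scheme" and K :: "('r, 'k) module" and M :: "('r, 'm) module"
    and N :: "('r, 'n) module" and u f
  assumes K: "right_module R K" and M: "right_module R M" and N: "right_module R N"
    and u: "u \<in> mod_hom R K M" and f: "f \<in> mod_hom R K N"
begin

interpretation K: right_module R K by (rule K)
interpretation M: right_module R M by (rule M)
interpretation N: right_module R N by (rule N)

lemma submodule_pushout_rel: "submodule_of R (mod_sum M N) (pushout_rel K N u f)"
proof -
  interpret D: right_module R "mod_sum M N" by (rule right_module_mod_sum[OF M N])
  note [simp] = mod_homD[OF u] mod_homD[OF f] mod_hom_minus[OF K M u] mod_hom_minus[OF K N f]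
    mod_hom_zero[OF K M u] mod_hom_zero[OF K N f]
  have inv: "\<ominus>\<^bsub>mod_sum M N\<^esub> (x, y) = (\<ominus>\<^bsub>M\<^esub> x, \<ominus>\<^bsub>N\<^esub> y)" if "x \<in> carrier M" "y \<in> carrier N" for x y
    by (rule D.M.minus_equality)
      (use that in \<open>auto simp: mod_sum_def M.M.l_neg N.M.l_neg\<close>)
  have "subgroup (pushout_rel K N u f) (add_monoid (mod_sum M N))"
  proof (rule D.M.add.subgroupI)
    show "pushout_rel K N u f \<noteq> {}"
      using K.M.zero_closed by (auto simp: pushout_rel_def)
  next
    fix a b assume "a \<in> pushout_rel K N u f" "b \<in> pushout_rel K N u f"
    then obtain k l where kl: "k \<in> carrier K" "l \<in> carrier K"
        "a = (u k, \<ominus>\<^bsub>N\<^esub> f k)" "b = (u l, \<ominus>\<^bsub>N\<^esub> f l)"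
      by (auto simp: pushout_rel_def)
    then have "a \<oplus>\<^bsub>mod_sum M N\<^esub> b = (u (k \<oplus>\<^bsub>K\<^esub> l), \<ominus>\<^bsub>N\<^esub> f (k \<oplus>\<^bsub>K\<^esub> l))"
      by (simp add: mod_sum_def N.M.minus_add)
    then show "a \<oplus>\<^bsub>mod_sum M N\<^esub> b \<in> pushout_rel K N u f"
      unfolding pushout_rel_def using kl K.M.a_closed by blast
  next
    fix a assume "a \<in> pushout_rel K N u f"
    then obtain k where k: "k \<in> carrier K" "a = (u k, \<ominus>\<^bsub>N\<^esub> f k)"
      by (auto simp: pushout_rel_def)
    then have "\<ominus>\<^bsub>mod_sum M N\<^esub> a = (u (\<ominus>\<^bsub>K\<^esub> k), \<ominus>\<^bsub>N\<^esub> f (\<ominus>\<^bsub>K\<^esub> k))"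
      by (simp add: inv)
    then show "\<ominus>\<^bsub>mod_sum M N\<^esub> a \<in> pushout_rel K N u f"
      unfolding pushout_rel_def using k K.M.a_inv_closed by blast
  qed (auto simp: pushout_rel_def mod_sum_def)
  moreover have "r \<odot>\<^bsub>mod_sum M N\<^esub> a \<in> pushout_rel K N u f"
    if "r \<in> carrier R" "a \<in> pushout_rel K N u f" for r a
  proof -
    obtain k where k: "k \<in> carrier K" "a = (u k, \<ominus>\<^bsub>N\<^esub> f k)"
      using \<open>a \<in> _\<close> by (auto simp: pushout_rel_def)
    then have "r \<odot>\<^bsub>mod_sum M N\<^esub> a = (u (r \<odot>\<^bsub>K\<^esub> k), \<ominus>\<^bsub>N\<^esub> f (r \<odot>\<^bsub>K\<^esub> k))"
      using that by (simp add: mod_sum_def N.smult_minus)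
    then show ?thesis
      unfolding pushout_rel_def using k K.smult_closed that by blast
  qed
  ultimately show ?thesis
    by (intro submodule_of.intro submodule_of_axioms.intro D.right_module_axioms
        additive_subgroup.intro)
qed

interpretation S: submodule_of R "mod_sum M N" "pushout_rel K N u f"
  by (rule submodule_pushout_rel)

lemma right_module_pushout: "right_module R (pushout K M N u f)"
  unfolding pushout_def by (rule S.right_module_quot)

lemma pushout_inl_hom: "pushout_inl K M N u f \<in> mod_hom R M (pushout K M N u f)"
proof -
  have i: "(\<lambda>x. (x, \<zero>\<^bsub>N\<^esub>)) \<in> mod_hom R M (mod_sum M N)"
    by (rule mod_homI) (auto simp: mod_sum_def N.smult_zero)
  show ?thesis
    using mod_homD[OF i] mod_homD[OF S.coset_hom] M.smult_closed
    by (intro mod_homI) (auto simp: pushout_inl_def pushout_def)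
qed

lemma pushout_inr_hom: "pushout_inr K M N u f \<in> mod_hom R N (pushout K M N u f)"
proof -
  have i: "(\<lambda>y. (\<zero>\<^bsub>M\<^esub>, y)) \<in> mod_hom R N (mod_sum M N)"
    by (rule mod_homI) (auto simp: mod_sum_def M.smult_zero)
  show ?thesis
    using mod_homD[OF i] mod_homD[OF S.coset_hom] N.smult_closed
    by (intro mod_homI) (auto simp: pushout_inr_def pushout_def)
qed

lemma pushout_commutes:
  assumes k: "k \<in> carrier K"
  shows "pushout_inl K M N u f (u k) = pushout_inr K M N u f (f k)"
proof -
  note uk = mod_homD(1)[OF u k] and fk = mod_homD(1)[OF f k]
  have "\<ominus>\<^bsub>mod_sum M N\<^esub> (\<zero>\<^bsub>M\<^esub>, f k) = (\<zero>\<^bsub>M\<^esub>, \<ominus>\<^bsub>N\<^esub> f k)"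
    by (rule S.M.minus_equality) (use fk in \<open>auto simp: mod_sum_def N.M.l_neg\<close>)
  then have "(u k, \<zero>\<^bsub>N\<^esub>) \<oplus>\<^bsub>mod_sum M N\<^esub> \<ominus>\<^bsub>mod_sum M N\<^esub> (\<zero>\<^bsub>M\<^esub>, f k) = (u k, \<ominus>\<^bsub>N\<^esub> f k)"
    using uk fk by (simp add: mod_sum_def)
  then have "(u k, \<zero>\<^bsub>N\<^esub>) \<oplus>\<^bsub>mod_sum M N\<^esub> \<ominus>\<^bsub>mod_sum M N\<^esub> (\<zero>\<^bsub>M\<^esub>, f k) \<in> pushout_rel K N u f"
    using k by (simp add: pushout_rel_def)
  moreover have "(u k, \<zero>\<^bsub>N\<^esub>) \<in> carrier (mod_sum M N)" "(\<zero>\<^bsub>M\<^esub>, f k) \<in> carrier (mod_sum M N)"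
    using uk fk by (simp_all add: mod_sum_def)
  ultimately show ?thesis
    by (simp add: pushout_inl_def pushout_inr_def S.coset_eq_iff)
qed

lemma pushout_carrierE:
  assumes "p \<in> carrier (pushout K M N u f)"
  obtains x y where "x \<in> carrier M" "y \<in> carrier N"
    "p = pushout_inl K M N u f x \<oplus>\<^bsub>pushout K M N u f\<^esub> pushout_inr K M N u f y"
proof -
  obtain x y where xy: "x \<in> carrier M" "y \<in> carrier N"
      "p = pushout_rel K N u f +>\<^bsub>mod_sum M N\<^esub> (x, y)"
    using assms by (auto simp: pushout_def S.quot_carrier) (auto simp: mod_sum_def)
  have "(x, \<zero>\<^bsub>N\<^esub>) \<in> carrier (mod_sum M N)" "(\<zero>\<^bsub>M\<^esub>, y) \<in> carrier (mod_sum M N)"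
       "(x, \<zero>\<^bsub>N\<^esub>) \<oplus>\<^bsub>mod_sum M N\<^esub> (\<zero>\<^bsub>M\<^esub>, y) = (x, y)"
    using xy by (simp_all add: mod_sum_def)
  then show ?thesis
    using xy S.quot_add_coset by (intro that) (auto simp: pushout_def pushout_inl_def pushout_inr_def)
qed

lemma pushout_universal:
  fixes T :: "('r, 't) module"
  assumes T: "right_module R T" and a: "a \<in> mod_hom R M T" and b: "b \<in> mod_hom R N T"
    and ab: "\<And>k. k \<in> carrier K \<Longrightarrow> a (u k) = b (f k)"
  shows "\<exists>h\<in>mod_hom R (pushout K M N u f) T.
    (\<forall>x\<in>carrier M. h (pushout_inl K M N u f x) = a x) \<and>
    (\<forall>y\<in>carrier N. h (pushout_inr K M N u f y) = b y)"
proof -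
  interpret T: right_module R T by fact
  define c where "c = (\<lambda>(x, y). a x \<oplus>\<^bsub>T\<^esub> b y)"
  have c: "c \<in> mod_hom R (mod_sum M N) T"
    by (rule mod_homI)
      (auto simp: c_def mod_sum_def mod_homD[OF a] mod_homD[OF b] T.smult_r_distr T.M.a_ac)
  have "c s = \<zero>\<^bsub>T\<^esub>" if "s \<in> pushout_rel K N u f" for s
    using that mod_homD(1)[OF b] mod_homD(1)[OF f]
    by (auto simp: pushout_rel_def c_def ab mod_hom_minus[OF N T b] T.M.r_neg)
  then obtain h where h: "h \<in> mod_hom R (pushout K M N u f) T"
      "\<And>z. z \<in> carrier (mod_sum M N) \<Longrightarrow> h (pushout_rel K N u f +>\<^bsub>mod_sum M N\<^esub> z) = c z"
    using S.quot_lift[OF T c] unfolding pushout_def by blast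
  have "h (pushout_inl K M N u f x) = a x" if "x \<in> carrier M" for x
    using h(2)[of "(x, \<zero>\<^bsub>N\<^esub>)"] that mod_homD(1)[OF a]
    by (simp add: pushout_inl_def c_def mod_hom_zero[OF N T b]) (simp add: mod_sum_def)
  moreover have "h (pushout_inr K M N u f y) = b y" if "y \<in> carrier N" for y
    using h(2)[of "(\<zero>\<^bsub>M\<^esub>, y)"] that mod_homD(1)[OF b]
    by (simp add: pushout_inr_def c_def mod_hom_zero[OF M T a]) (simp add: mod_sum_def)
  ultimately show ?thesis
    using h(1) by blast
qed

lemma pushout_unique:
  fixes T :: "('r, 't) module"
  assumes h: "h \<in> mod_hom R (pushout K M N u f) T" and h': "h' \<in> mod_hom R (pushout K M N u f) T"
    and "\<And>x. x \<in> carrier M \<Longrightarrow> h (pushout_inl K M N u f x) = h' (pushout_inl K M N u f x)"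
    and "\<And>y. y \<in> carrier N \<Longrightarrow> h (pushout_inr K M N u f y) = h' (pushout_inr K M N u f y)"
    and p: "p \<in> carrier (pushout K M N u f)"
  shows "h p = h' p"
  using p
proof (rule pushout_carrierE)
  fix x y
  assume "x \<in> carrier M" "y \<in> carrier N"
    "p = pushout_inl K M N u f x \<oplus>\<^bsub>pushout K M N u f\<^esub> pushout_inr K M N u f y"
  then show ?thesis
    using assms(3,4) mod_homD(2)[OF h] mod_homD(2)[OF h']
      mod_homD(1)[OF pushout_inl_hom] mod_homD(1)[OF pushout_inr_hom] by metis
qed

end

end

theory Submission
  imports Defs
begin

text \<open>
  If \<open>g u = u\<close>, then both structure maps of the pushout of \<open>u\<close> and \<open>g u\<close> are split by the
  codiagonal, so \<open>g u\<close> is a partial isomorphism and smallness makes \<open>g\<close> a pure monomorphism.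
  As \<open>E\<close> is pure-injective, \<open>g\<close> has a retraction \<open>h\<close>. Since \<open>h u = h g u = u\<close>, the same
  argument shows that \<open>h\<close> is injective, and \<open>h g h = h\<close> then yields \<open>g h = 1\<close>.
\<close>

lemma mod_hom_id: "(\<lambda>x. x) \<in> mod_hom R M M"
  by (simp add: mod_hom_def)

lemma mod_hom_comp:
  assumes "f \<in> mod_hom R K M" "g \<in> mod_hom R M N"
  shows "g \<circ> f \<in> mod_hom R K N"
  by (rule mod_homI) (simp_all add: mod_homD[OF assms(1)] mod_homD[OF assms(2)])

lemma mod_hom_finsum:
  assumes M: "right_module R M" and N: "right_module R N" and h: "h \<in> mod_hom R M N"
    and "finite I" "\<And>i. i \<in> I \<Longrightarrow> x i \<in> carrier M"
  shows "h (\<Oplus>\<^bsub>M\<^esub>i\<in>I. x i) = (\<Oplus>\<^bsub>N\<^esub>i\<in>I. h (x i))"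
proof -
  interpret M: right_module R M by fact
  interpret N: right_module R N by fact
  show ?thesis
    using assms(4,5)
  proof (induction I rule: finite_induct)
    case empty
    then show ?case by (simp add: mod_hom_zero[OF M N h])
  next
    case (insert i I)
    then show ?case
      by (simp add: M.M.finsum_insert N.M.finsum_insert Pi_def mod_homD[OF h])
  qed
qed

text \<open>A retraction \<open>p\<close> carries a solution \<open>y\<close> of the system in
  \<open>N\<close> to the solution \<open>p (y i)\<close> in \<open>M\<close>: it commutes with
  finite sums and scalars, and it sends each constant \<open>h (a j)\<close> back to
  \<open>a j\<close>.\<close>

lemma split_mono_pure:
  assumes M: "right_module R M" and N: "right_module R N"
    and h: "h \<in> mod_hom R M N" and p: "p \<in> mod_hom R N M"
    and ph: "\<And>x. x \<in> carrier M \<Longrightarrow> p (h x) = x"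
  shows "pure_mono R M N h"
proof -
  interpret M: right_module R M by fact
  interpret N: right_module R N by fact
  have "inj_on h (carrier M)"
    using ph by (rule inj_on_inverseI)
  moreover have "\<exists>x. (\<forall>i<n. x i \<in> carrier M) \<and>
      (\<forall>j<m. (\<Oplus>\<^bsub>M\<^esub>i\<in>{..<n}. r i j \<odot>\<^bsub>M\<^esub> x i) = a j)"
    if r: "\<forall>i<n. \<forall>j<m. r i j \<in> carrier R" and a: "\<forall>j<m. a j \<in> carrier M"
      and y: "\<forall>i<n. y i \<in> carrier N" "\<forall>j<m. (\<Oplus>\<^bsub>N\<^esub>i\<in>{..<n}. r i j \<odot>\<^bsub>N\<^esub> y i) = h (a j)"
    for n m :: nat and r a y
  proof (intro exI conjI allI impI)
    show "p (y i) \<in> carrier M" if "i < n" for i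
      using that y(1) mod_homD(1)[OF p] by blast
    show "(\<Oplus>\<^bsub>M\<^esub>i\<in>{..<n}. r i j \<odot>\<^bsub>M\<^esub> p (y i)) = a j" if j: "j < m" for j
    proof -
      have "(\<Oplus>\<^bsub>M\<^esub>i\<in>{..<n}. r i j \<odot>\<^bsub>M\<^esub> p (y i)) = (\<Oplus>\<^bsub>M\<^esub>i\<in>{..<n}. p (r i j \<odot>\<^bsub>N\<^esub> y i))"
        using r y(1) j
        by (intro M.M.finsum_cong') (auto simp: mod_homD[OF p] N.smult_closed M.smult_closed)
      also have "\<dots> = p (\<Oplus>\<^bsub>N\<^esub>i\<in>{..<n}. r i j \<odot>\<^bsub>N\<^esub> y i)"
        using r y(1) j by (intro mod_hom_finsum[OF N M p, symmetric]) (auto simp: N.smult_closed)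
      also have "\<dots> = a j"
        using y(2) a j ph by simp
      finally show ?thesis .
    qed
  qed
  ultimately show ?thesis
    using h unfolding pure_mono_def mod_mono_def by blast
qed

lemma partial_isomorphism_of_fixing_endo:
  assumes K: "right_module R K" and M: "right_module R M" and mono: "mod_mono R K M u"
    and g: "g \<in> mod_hom R M M" and gu: "\<And>k. k \<in> carrier K \<Longrightarrow> g (u k) = u k"
  shows "partial_isomorphism R K M M u (g \<circ> u)"
proof -
  have u': "u \<in> mod_hom R K M"
    using mono by (simp add: mod_mono_def)
  note gu' = mod_hom_comp[OF u' g]
  interpret pushout_data R K M M u "g \<circ> u"
    by (intro pushout_data.intro K M u' gu')
  \<comment> \<open>The codiagonal comes from the universal property with the identity of
    \<open>M\<close> on both summands. The compatibility condition is then
    \<open>u k = g (u k)\<close>, which is exactly \<open>gu\<close>.\<close>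
  obtain p where p: "p \<in> mod_hom R (pushout K M M u (g \<circ> u)) M"
      "\<And>x. x \<in> carrier M \<Longrightarrow> p (pushout_inl K M M u (g \<circ> u) x) = x"
      "\<And>y. y \<in> carrier M \<Longrightarrow> p (pushout_inr K M M u (g \<circ> u) y) = y"
    using pushout_universal[OF M mod_hom_id mod_hom_id] gu by (metis comp_apply)
  \<comment> \<open>The injection is left open, since the single map \<open>p\<close> retracts both
    structure maps.\<close>
  note split = split_mono_pure[OF M right_module_pushout _ p(1)]
  show ?thesis
    unfolding partial_isomorphism_def
    using mono gu' split[OF pushout_inl_hom p(2)] split[OF pushout_inr_hom p(3)] by blast
qed

text \<open>Smallness is applied with \<open>E\<close> itself as the test module. The endomorphism
  stays arbitrary because the result is needed both for \<open>g\<close> and for its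
  retraction.\<close>

lemma pure_mono_of_fixing_endo:
  assumes "right_module R M" "right_module R E" "ziegler_small_extension R M E u"
    and "g \<in> mod_hom R E E" "\<And>x. x \<in> carrier M \<Longrightarrow> g (u x) = u x"
  shows "pure_mono R E E g"
  using assms partial_isomorphism_of_fixing_endo[of R M E u g]
  unfolding ziegler_small_extension_def by blast

theorem proposition1p6:
  fixes R :: "('r, 'x) ring_scheme"
    and M E :: "('r, 'u) module"
    and u :: "'u \<Rightarrow> 'u"
  assumes "ring R"
    and "right_module R M" and "right_module R E"
    and "pure_injective R E"
    and "ziegler_small_extension R M E u"
  shows "mod_mono R M E u \<and> left_minimal R M E u"
proof -
  have u: "mod_mono R M E u"
    using assms(5) by (simp add: ziegler_small_extension_def)
  have "mod_iso R E E g"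
    if g: "g \<in> mod_hom R E E" and gu: "\<forall>x\<in>carrier M. g (u x) = u x" for g
  proof -
    note pure = pure_mono_of_fixing_endo[OF assms(2,3,5)]
    have pg: "pure_mono R E E g"
      using pure[OF g] gu by blast
    \<comment> \<open>Pure-injectivity with both test modules equal to \<open>E\<close> extends the
      identity of \<open>E\<close> along the pure monomorphism \<open>g\<close>.\<close>
    obtain h where h: "h \<in> mod_hom R E E" and hg: "\<forall>x\<in>carrier E. h (g x) = x"
      using assms(3,4) pg mod_hom_id[of R E] unfolding pure_injective_def by blast
    \<comment> \<open>Rewrite \<open>u x\<close> as \<open>g (u x)\<close>, then cancel with
      \<open>hg\<close> at the point \<open>u x\<close> of \<open>E\<close>.\<close>
    have "h (u x) = u x" if "x \<in> carrier M" for x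
      using that gu hg u mod_homD(1)[of u R M E] unfolding mod_mono_def by metis
    then have inj_h: "inj_on h (carrier E)"
      using pure[OF h] by (simp add: pure_mono_def mod_mono_def)
    \<comment> \<open>By \<open>hg\<close> at \<open>h y\<close>, the elements
      \<open>g (h y)\<close> and \<open>y\<close> have the same image under the injective map
      \<open>h\<close>.\<close>
    have "g (h y) = y" if "y \<in> carrier E" for y
      using inj_onD[OF inj_h] hg that mod_homD(1)[OF g] mod_homD(1)[OF h] by blast
    then have "bij_betw g (carrier E) (carrier E)"
      using hg mod_homD(1)[OF g] mod_homD(1)[OF h] by (intro bij_betwI[where g = h]) auto
    then show ?thesis
      using g by (simp add: mod_iso_def)
  qed
  then show ?thesis
    using u by (simp add: left_minimal_def mod_mono_def)
qed

end
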